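(* Let $d\ge1$, let $\omega_1,\dots,\omega_d$ be the $d$-th roots of unity, and let $$P_0(z)=-\tfrac1dz^d+a_{d-1}z^{d-1}+\dots+a_1z+a_0,\qquad Q_0(z)=-\tfrac1dz^d+b_{d-1}z^{d-1}+\dots+b_1z+b_0$$ be two normalized polynomials with complex coefficients. Put $F_j(z)=\int_0^zt^je^{P_0(t)}dt$ and $G_j(z)=\int_0^zt^je^{Q_0(t)}dt$. If for all $j=0,\dots,d-1$ and $k=1,\dots,d$ $$F_j(+\infty\cdot\omega_k)=G_j(+\infty\cdot\omega_k),$$ then $e^{a_0}a_j=e^{b_0}b_j$ for $j=1,\dots,d-1$, i.e. $$e^{P_0(0)}\bigl(P_0(z)-P_0(0)\bigr)=e^{Q_0(0)}\bigl(Q_0(z)-Q_0(0)\bigr).$$ In particular, if the polynomials $P_0$ and $Q_0$ have no constant term, then $P_0=Q_0$.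
   Context: $F(+\infty\cdot\omega)$ denotes $\lim_{t\to+\infty}F(t\omega)$, $t$ real. *)

theory Defs
  imports "HOL-Complex_Analysis.Complex_Analysis"
begin

text \<open>The polynomial \<open>- z^d / d + c (d - 1) * z^(d - 1) + ... + c 1 * z + c 0\<close>.
  Only the values \<open>c 0, ..., c (d - 1)\<close> matter.\<close>

definition normalized_poly :: "nat \<Rightarrow> (nat \<Rightarrow> complex) \<Rightarrow> complex poly" where
  "normalized_poly d c = monom (- (1 / of_nat d)) d + (\<Sum>j<d. monom (c j) j)"

text \<open>The integrand is entire, so integrating along the segment from \<open>0\<close> to \<open>z\<close>
  gives the path-independent integral.\<close>

definition exp_primitive :: "complex poly \<Rightarrow> nat \<Rightarrow> complex \<Rightarrow> complex" where
  "exp_primitive P j z = contour_integral (linepath 0 z) (\<lambda>t. t ^ j * exp (poly P t))"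

text \<open>\<open>F(+\<infinity>\<cdot>\<omega>)\<close>. The value is meaningful only if the limit exists, which is the case for
  \<open>exp_primitive (normalized_poly d c) j\<close> with \<open>d \<ge> 1\<close> and \<open>\<omega>^d = 1\<close>: there the real part of the
  exponent at \<open>t * \<omega>\<close> is \<open>- t^d / d\<close> plus terms of lower order.\<close>

definition ray_limit :: "(complex \<Rightarrow> complex) \<Rightarrow> complex \<Rightarrow> complex" where
  "ray_limit F \<omega> = Lim at_top (\<lambda>t::real. F (of_real t * \<omega>))"

end

theory Submission
  imports Defs
begin

text \<open>
  Integrating \<open>P' e\<^sup>P\<close> along the ray of a \<open>d\<close>-th root of unity \<open>\<omega>\<close>, on which \<open>e\<^sup>P\<close> decays, gives
  \<open>- exp (P 0)\<close>. For a normalized polynomial \<open>P\<close> of degree \<open>d\<close> this is a linear relation between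
  the numbers \<open>F\<^sub>j(\<infinity>\<cdot>\<omega>)\<close>, \<open>j < d\<close>, whose coefficients are those of \<open>P'\<close>
  (\<open>ray_limits_pderiv\<close>). Divide it by \<open>exp (P 0)\<close>, and divide the corresponding relation for \<open>Q\<close> by
  \<open>exp (Q 0)\<close>. If \<open>P\<close> and \<open>Q\<close> have the same ray limits, the difference of the two says that the
  polynomial \<open>A = exp (- P 0) P' - exp (- Q 0) Q'\<close>, of degree below \<open>d\<close>, satisfies
  \<open>\<integral> A e\<^sup>P = 0\<close> along all \<open>d\<close> rays. If this forces \<open>A = 0\<close>, then comparing the leading coefficients
  (both derivatives start with \<open>- z^(d - 1)\<close>) yields \<open>exp (P 0) = exp (Q 0)\<close>, hence \<open>P' = Q'\<close>, and
  the claims follow.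

  The essential point is thus the independence statement \<open>ray_limits_independent\<close>, the
  nonvanishing of the determinant of the \<open>F\<^sub>j(\<infinity>\<cdot>\<omega>\<^sub>k)\<close>. It is proved without computing the
  determinant. Let \<open>H\<close> be the primitive of \<open>A e\<^sup>P\<close> with \<open>H 0 = 0\<close>, and suppose that \<open>H\<close> tends to \<open>0\<close>
  along all the rays. Then the entire function \<open>E = H e\<^sup>-\<^sup>P\<close> is bounded (\<open>primitive_eq_0\<close>), so it is
  constant by Liouville's theorem, and \<open>E 0 = 0\<close> gives \<open>H = 0\<close> and \<open>A = 0\<close>.

  Boundedness rests on one estimate (\<open>path_estimate\<close>): along a path on which \<open>Re P\<close> is monotone, and
  changes at a speed of at least \<open>|A| / K\<close>, the increment of \<open>H\<close> is at most \<open>K\<close> times the increment of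
  \<open>exp (Re P)\<close>. Far from the origin \<open>P\<close> behaves like \<open>- z^d / d\<close>, so with \<open>\<theta>\<close> the angle between \<open>z\<close> and
  the closest ray the following paths qualify. For \<open>d \<theta> \<le> \<pi> / 3\<close> go from \<open>z\<close> radially to infinity, where \<open>H\<close>
  vanishes. For \<open>\<pi> / 3 \<le> d \<theta> \<le> 2 \<pi> / 3\<close> reach \<open>z\<close> from the first region by a circular arc. For
  \<open>2 \<pi> / 3 \<le> d \<theta> \<le> \<pi>\<close> come radially from a fixed circle. The regions are chosen such that the cosine
  of \<open>d \<theta>\<close> on the radial paths, and its sine on the arcs, are at least \<open>1 / 2\<close> in absolute value and so
  dominate the terms of lower order.
\<close>

section \<open>Growth of polynomials and roots of unity\<close>

lemma poly_growth:
  fixes p :: "complex poly"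
  assumes "degree p \<le> n"
  obtains B where "B \<ge> 0" "\<And>z. 1 \<le> norm z \<Longrightarrow> norm (poly p z) \<le> B * norm z ^ n"
proof
  show "(\<Sum>i\<le>degree p. norm (coeff p i)) \<ge> 0"
    by (simp add: sum_nonneg)
  fix z :: complex assume z: "1 \<le> norm z"
  have "norm (poly p z) \<le> (\<Sum>i\<le>degree p. norm (coeff p i) * norm z ^ i)"
    unfolding poly_altdef by (rule order_trans[OF norm_sum]) (simp add: norm_mult norm_power)
  also have "\<dots> \<le> (\<Sum>i\<le>degree p. norm (coeff p i) * norm z ^ n)"
    using z assms by (intro sum_mono mult_left_mono power_increasing) auto
  finally show "norm (poly p z) \<le> (\<Sum>i\<le>degree p. norm (coeff p i)) * norm z ^ n"
    by (simp add: sum_distrib_right)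
qed

lemma poly_negligible:
  fixes p :: "complex poly"
  assumes "degree p < d" "0 < \<epsilon>"
  obtains R where "R \<ge> 1" "\<And>z. R \<le> norm z \<Longrightarrow> norm (poly p z) \<le> \<epsilon> * norm z ^ d"
proof -
  have "degree p \<le> d - 1" using assms by simp
  then obtain B where B: "B \<ge> 0" "\<And>z. 1 \<le> norm z \<Longrightarrow> norm (poly p z) \<le> B * norm z ^ (d - 1)"
    using poly_growth[of p "d - 1"] by blast
  show thesis
  proof
    show "1 \<le> max 1 (B / \<epsilon>)" by simp
    fix z :: complex assume z: "max 1 (B / \<epsilon>) \<le> norm z"
    have "norm (poly p z) \<le> B * norm z ^ (d - 1)" using z B by simp
    also have "\<dots> \<le> (\<epsilon> * norm z) * norm z ^ (d - 1)"
      using z assms by (intro mult_right_mono) (auto simp: field_simps)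
    also have "\<dots> = \<epsilon> * norm z ^ d"
      using assms by (simp add: power_eq_if)
    finally show "norm (poly p z) \<le> \<epsilon> * norm z ^ d" .
  qed
qed

lemma norm_root_of_unity:
  fixes \<omega> :: complex
  assumes "1 \<le> d" "\<omega> ^ d = 1"
  shows "norm \<omega> = 1"
  using assms by (metis norm_one norm_power power_eq_1_iff not_one_le_zero norm_ge_zero)

text \<open>Rounding \<open>d Arg z / (2 \<pi>)\<close> to an integer selects the root of unity. The deviation of \<open>Arg z\<close> from
  its argument is split into a sign \<open>\<sigma>\<close> and a size \<open>\<theta>\<close>, so that the estimates below treat both sides of
  a ray at once.\<close>

lemma nearest_root_of_unity:
  assumes "1 \<le> (d::nat)"
  obtains \<omega> :: complex and \<sigma> \<theta> :: real where "\<omega> ^ d = 1" "\<sigma> = 1 \<or> \<sigma> = - 1"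
    "0 \<le> \<theta>" "d * \<theta> \<le> pi" "z = of_real (norm z) * (\<omega> * cis (\<sigma> * \<theta>))"
proof
  define n where "n = round (d * Arg z / (2 * pi))"
  define \<delta> where "\<delta> = Arg z - 2 * pi * n / d"
  have "cis (2 * pi * n / d) ^ d = cis (real d * (2 * pi * n / d))" by (rule Complex.DeMoivre)
  also have "real d * (2 * pi * n / d) = 2 * pi * n" using assms by simp
  also have "cis (2 * pi * n) = 1" by (rule cis_multiple_2pi) simp
  finally show "cis (2 * pi * n / d) ^ d = 1" .
  show "(if \<delta> \<ge> 0 then 1 else - 1) = (1::real) \<or> (if \<delta> \<ge> 0 then 1 else - 1) = (- 1::real)"
    by auto
  show "0 \<le> \<bar>\<delta>\<bar>" by simp
  have "\<bar>n - d * Arg z / (2 * pi)\<bar> \<le> 1 / 2"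
    unfolding n_def by (rule of_int_round_abs_le)
  then have "\<bar>n - d * Arg z / (2 * pi)\<bar> * (2 * pi) \<le> pi" by (simp add: field_simps)
  also have "\<bar>n - d * Arg z / (2 * pi)\<bar> * (2 * pi) = \<bar>(n - d * Arg z / (2 * pi)) * (2 * pi)\<bar>"
    by (simp add: abs_mult)
  also have "(n - d * Arg z / (2 * pi)) * (2 * pi) = - (d * \<delta>)"
    using assms by (simp add: \<delta>_def field_simps)
  finally show "d * \<bar>\<delta>\<bar> \<le> pi" by (simp add: abs_mult)
  have "(if \<delta> \<ge> 0 then 1 else - 1) * \<bar>\<delta>\<bar> = \<delta>" by auto
  then have "cis (2 * pi * n / d) * cis ((if \<delta> \<ge> 0 then 1 else - 1) * \<bar>\<delta>\<bar>) = cis (Arg z)"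
    by (simp add: cis_mult \<delta>_def)
  then show "z = of_real (norm z) * (cis (2 * pi * n / d) * cis ((if \<delta> \<ge> 0 then 1 else - 1) * \<bar>\<delta>\<bar>))"
    using rcis_cmod_Arg[of z] by (simp add: rcis_def)
qed

section \<open>Integrals of a polynomial times an exponential along monotone paths\<close>

text \<open>If the integrand \<open>Q e\<^sup>P\<close> is dominated along a path by a constant multiple \<open>K\<close> of the
  derivative of \<open>exp (Re P)\<close>, then so is the integral. A negative \<open>K\<close> covers paths along which
  \<open>Re P\<close> decreases.\<close>

lemma path_estimate:
  fixes P Q :: "complex poly" and \<gamma> :: "real \<Rightarrow> complex"
  assumes H: "\<And>z. (H has_field_derivative poly Q z * exp (poly P z)) (at z)"
    and \<gamma>: "\<And>x. (\<gamma> has_vector_derivative \<gamma>' x) (at x)"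
    and "a \<le> b"
    and dom: "\<And>x. a \<le> x \<Longrightarrow> x \<le> b \<Longrightarrow>
      norm (poly Q (\<gamma> x)) * norm (\<gamma>' x) \<le> K * Re (poly (pderiv P) (\<gamma> x) * \<gamma>' x)"
  shows "norm (H (\<gamma> b) - H (\<gamma> a)) \<le> K * (exp (Re (poly P (\<gamma> b))) - exp (Re (poly P (\<gamma> a))))"
proof (cases "a = b")
  case False
  define \<phi> where "\<phi> = (\<lambda>x. K * exp (Re (poly P (\<gamma> x))))"
  have H': "((\<lambda>x. H (\<gamma> x)) has_vector_derivative \<gamma>' x * (poly Q (\<gamma> x) * exp (poly P (\<gamma> x)))) (at x)" for x
    using field_vector_diff_chain_at[OF \<gamma> H] by (simp add: o_def)
  have P': "((\<lambda>x. poly P (\<gamma> x)) has_vector_derivative \<gamma>' x * poly (pderiv P) (\<gamma> x)) (at x)" for x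
    using field_vector_diff_chain_at[OF \<gamma> poly_DERIV] by (simp add: o_def)
  have "((\<lambda>x. Re (poly P (\<gamma> x))) has_vector_derivative Re (\<gamma>' x * poly (pderiv P) (\<gamma> x))) (at x)" for x
    by (rule bounded_linear.has_vector_derivative[OF bounded_linear_Re P'])
  then have Re': "((\<lambda>x. Re (poly P (\<gamma> x))) has_field_derivative Re (\<gamma>' x * poly (pderiv P) (\<gamma> x))) (at x)" for x
    by (simp add: has_real_derivative_iff_has_vector_derivative)
  have \<phi>': "(\<phi> has_vector_derivative
      K * (exp (Re (poly P (\<gamma> x))) * Re (\<gamma>' x * poly (pderiv P) (\<gamma> x)))) (at x)" for x
    unfolding \<phi>_def has_real_derivative_iff_has_vector_derivative[symmetric]
    by (rule derivative_eq_intros Re' refl)+ simp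
  have "norm (H (\<gamma> b) - H (\<gamma> a)) \<le> \<phi> b - \<phi> a"
  proof (rule differentiable_bound_general[OF _ _ _ H' \<phi>'])
    show "a < b" using False \<open>a \<le> b\<close> by simp
    show "continuous_on {a..b} (\<lambda>x. H (\<gamma> x))" "continuous_on {a..b} \<phi>"
      using has_vector_derivative_continuous[OF H'] has_vector_derivative_continuous[OF \<phi>']
      by (auto simp: continuous_on_eq_continuous_within continuous_at_imp_continuous_within)
    fix x assume "a < x" "x < b"
    then have "exp (Re (poly P (\<gamma> x))) * (norm (poly Q (\<gamma> x)) * norm (\<gamma>' x))
        \<le> exp (Re (poly P (\<gamma> x))) * (K * Re (poly (pderiv P) (\<gamma> x) * \<gamma>' x))"
      by (intro mult_left_mono dom) auto
    then show "norm (\<gamma>' x * (poly Q (\<gamma> x) * exp (poly P (\<gamma> x))))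
        \<le> K * (exp (Re (poly P (\<gamma> x))) * Re (\<gamma>' x * poly (pderiv P) (\<gamma> x)))"
      by (simp add: norm_mult mult_ac)
  qed
  then show ?thesis by (simp add: \<phi>_def algebra_simps)
qed simp

lemma sign_mult_le: "\<bar>e\<bar> \<le> c \<Longrightarrow> \<sigma> = 1 \<or> \<sigma> = - 1 \<Longrightarrow> \<sigma> * e \<le> (c::real)"
  by auto

text \<open>What the estimates need to know about \<open>P\<close> is only that, outside the disc of radius \<open>R\<close>, it is
  close to \<open>- z^d / d\<close>. The factors \<open>1 / 4\<close> leave at least half of the contribution of the leading term
  wherever the real part or the imaginary part of \<open>z^d\<close> that matters is at least half of \<open>|z|^d\<close>.\<close>

locale exp_poly_integral =
  fixes d :: nat and P Q :: "complex poly" and H :: "complex \<Rightarrow> complex" and C R :: real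
  assumes d: "1 \<le> d"
    and H: "\<And>z. (H has_field_derivative poly Q z * exp (poly P z)) (at z)"
    and C: "0 < C" and R: "1 \<le> R"
    and Q_le: "\<And>z. R \<le> norm z \<Longrightarrow> norm (poly Q z) \<le> C * norm z ^ (d - 1)"
    and P'_approx: "\<And>z. R \<le> norm z \<Longrightarrow> norm (z * poly (pderiv P) z + z ^ d) \<le> norm z ^ d / 4"
    and P_approx: "\<And>z. R \<le> norm z \<Longrightarrow> norm (poly P z + z ^ d / of_nat d) \<le> norm z ^ d / (4 * d)"
begin

lemma Q_le': "R \<le> norm z \<Longrightarrow> norm z * norm (poly Q z) \<le> C * norm z ^ d"
  using Q_le[of z] d mult_left_mono[of "norm (poly Q z)" "C * norm z ^ (d - 1)" "norm z"]
  by (simp add: power_eq_if mult_ac)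

text \<open>The derivative of \<open>Re P\<close> along a ray is \<open>Re (z P') / |z|\<close>, which, if \<open>Re (u^d)\<close> is not
  smaller than \<open>1 / 2\<close> in absolute value, has the sign of \<open>- Re (u^d)\<close> and size at least
  \<open>|z|^(d - 1) / 4\<close>. The sign \<open>\<sigma>\<close> is \<open>1\<close> where \<open>e\<^sup>P\<close> grows and \<open>- 1\<close> where it
  decays.\<close>

lemma radial_estimate:
  assumes u: "norm u = 1" and "R \<le> s" "s \<le> t"
    and \<sigma>: "\<sigma> = 1 \<or> \<sigma> = - 1" "\<sigma> * Re (u ^ d) \<le> - 1 / 2"
  shows "norm (H (of_real t * u) - H (of_real s * u))
    \<le> 4 * C * \<sigma> * (exp (Re (poly P (of_real t * u))) - exp (Re (poly P (of_real s * u))))"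
proof (rule path_estimate[OF H, where \<gamma>' = "\<lambda>_. u"])
  fix x show "((\<lambda>x. of_real x * u) has_vector_derivative u) (at x)"
    by (auto intro!: derivative_eq_intros simp: has_vector_derivative_def scaleR_conv_of_real)
next
  fix x assume x: "s \<le> x" "x \<le> t"
  define z where "z = of_real x * u"
  have x1: "x \<ge> 1" and xR: "x \<ge> R" using x R assms by auto
  have nz: "norm z = x" using u x1 by (simp add: z_def norm_mult)
  have "\<bar>Re (z * poly (pderiv P) z + z ^ d)\<bar> \<le> x ^ d / 4"
    using order_trans[OF abs_Re_le_cmod P'_approx[of z]] nz xR by simp
  then have "- \<sigma> * Re (z * poly (pderiv P) z + z ^ d) \<le> x ^ d / 4"
    using \<sigma>(1) by (intro sign_mult_le) auto
  moreover have "Re (z ^ d) = x ^ d * Re (u ^ d)"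
    by (simp add: z_def power_mult_distrib flip: of_real_power)
  moreover have "x ^ d * (\<sigma> * Re (u ^ d)) \<le> x ^ d * (- 1 / 2)"
    using \<sigma> x1 by (intro mult_left_mono) auto
  ultimately have "x ^ d / 4 \<le> \<sigma> * Re (z * poly (pderiv P) z)"
    unfolding plus_complex.sel distrib_left mult_minus_left by (simp add: mult_ac)
  then have "C * x ^ d \<le> (4 * C) * (\<sigma> * Re (z * poly (pderiv P) z))"
    using C mult_left_mono[of "x ^ d / 4" "\<sigma> * Re (z * poly (pderiv P) z)" "4 * C"]
    by (simp del: times_complex.sel)
  with Q_le'[of z] nz xR have "x * norm (poly Q z) \<le> (4 * C) * (\<sigma> * Re (z * poly (pderiv P) z))"
    by simp
  also have "Re (z * poly (pderiv P) z) = x * Re (poly (pderiv P) z * u)"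
    unfolding z_def by (simp add: algebra_simps)
  finally have "x * norm (poly Q z) \<le> x * (4 * C * \<sigma> * Re (poly (pderiv P) z * u))"
    by (simp add: mult_ac)
  then show "norm (poly Q (of_real x * u)) * norm u
      \<le> 4 * C * \<sigma> * Re (poly (pderiv P) (of_real x * u) * u)"
    using x1 u unfolding z_def[symmetric] by simp
qed (use assms in auto)

lemma arc_derivative:
  "((\<lambda>x. z * cis (\<sigma> * x)) has_vector_derivative of_real \<sigma> * \<i> * (z * cis (\<sigma> * x))) (at x)"
proof -
  have "((\<lambda>w. z * exp (\<i> * (of_real \<sigma> * w))) has_field_derivative
      of_real \<sigma> * \<i> * (z * cis (\<sigma> * x))) (at (of_real x))"
    by (auto intro!: derivative_eq_intros simp: cis_conv_exp)
  from has_vector_derivative_real_field[OF this] show ?thesis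
    by (simp add: cis_conv_exp)
qed

text \<open>Along a circle the derivative of \<open>Re P\<close> with respect to the angle is \<open>- Im (z P')\<close>, close to
  \<open>Im (z^d)\<close>. The sign \<open>\<sigma>\<close> selects the orientation of the arc.\<close>

lemma arc_estimate:
  assumes z: "R \<le> norm z" and "\<alpha> \<le> \<beta>" and \<sigma>: "\<sigma> = 1 \<or> \<sigma> = - 1"
    and im: "\<And>x. \<alpha> \<le> x \<Longrightarrow> x \<le> \<beta> \<Longrightarrow> norm z ^ d / 2 \<le> \<sigma> * Im ((z * cis (\<sigma> * x)) ^ d)"
  shows "norm (H (z * cis (\<sigma> * \<beta>)) - H (z * cis (\<sigma> * \<alpha>)))
    \<le> 4 * C * (exp (Re (poly P (z * cis (\<sigma> * \<beta>)))) - exp (Re (poly P (z * cis (\<sigma> * \<alpha>)))))"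
proof (rule path_estimate[OF H arc_derivative \<open>\<alpha> \<le> \<beta>\<close>])
  fix x assume x: "\<alpha> \<le> x" "x \<le> \<beta>"
  define w where "w = z * cis (\<sigma> * x)"
  have nw: "norm w = norm z" by (simp add: w_def norm_mult)
  have "\<bar>Im (w * poly (pderiv P) w + w ^ d)\<bar> \<le> norm w ^ d / 4"
    using order_trans[OF abs_Im_le_cmod P'_approx[of w]] nw z by simp
  then have "\<sigma> * Im (w * poly (pderiv P) w + w ^ d) \<le> norm w ^ d / 4"
    using \<sigma> by (rule sign_mult_le)
  moreover have "norm w ^ d / 2 \<le> \<sigma> * Im (w ^ d)"
    using im[OF x] unfolding w_def[symmetric] nw .
  ultimately have "norm w ^ d / 4 \<le> - \<sigma> * Im (w * poly (pderiv P) w)"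
    unfolding plus_complex.sel distrib_left mult_minus_left by linarith
  then have "C * norm w ^ d \<le> (4 * C) * (- \<sigma> * Im (w * poly (pderiv P) w))"
    using C mult_left_mono[of "norm w ^ d / 4" "- \<sigma> * Im (w * poly (pderiv P) w)" "4 * C"]
    by (simp del: times_complex.sel)
  also have "- \<sigma> * Im (w * poly (pderiv P) w) = Re (poly (pderiv P) w * (of_real \<sigma> * \<i> * w))"
    by (simp add: algebra_simps)
  finally have "norm w * norm (poly Q w) \<le> 4 * C * Re (poly (pderiv P) w * (of_real \<sigma> * \<i> * w))"
    using Q_le'[of w] nw z by simp
  then show "norm (poly Q (z * cis (\<sigma> * x))) * norm (of_real \<sigma> * \<i> * (z * cis (\<sigma> * x)))
      \<le> 4 * C * Re (poly (pderiv P) (z * cis (\<sigma> * x)) * (of_real \<sigma> * \<i> * (z * cis (\<sigma> * x))))"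
    unfolding w_def[symmetric] using \<sigma> by (auto simp: norm_mult mult_ac)
qed

section \<open>Decay of the exponential near the rays\<close>

lemma Re_P_le:
  assumes "R \<le> norm z" "norm z ^ d / 2 \<le> Re (z ^ d)"
  shows "Re (poly P z) \<le> - (norm z ^ d / (4 * d))"
proof -
  have "Re (poly P z + z ^ d / of_nat d) \<le> norm z ^ d / (4 * d)"
    using order_trans[OF complex_Re_le_cmod P_approx[OF assms(1)]] .
  moreover have "norm z ^ d / (2 * d) \<le> Re (z ^ d) / d"
    using assms(2) d by (simp add: field_simps)
  ultimately show ?thesis by simp
qed

lemma ray_at_top: "filterlim (\<lambda>t::real. t ^ d / (4 * d)) at_top at_top"
proof -
  have "filterlim (\<lambda>t::real. 1 / (4 * d) * t ^ d) at_top at_top"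
    using d by (intro filterlim_tendsto_pos_mult_at_top[OF tendsto_const]
        filterlim_pow_at_top filterlim_ident) auto
  then show ?thesis by simp
qed

lemma exp_P_ray_tendsto_0:
  assumes "norm u = 1" "1 / 2 \<le> Re (u ^ d)"
  shows "((\<lambda>t. exp (Re (poly P (of_real t * u)))) \<longlongrightarrow> 0) at_top"
proof (rule tendsto_sandwich[OF _ _ tendsto_const])
  show "((\<lambda>t. exp (- (t ^ d / (4 * d)))) \<longlongrightarrow> 0) (at_top :: real filter)"
    by (intro filterlim_compose[OF exp_at_bot] filterlim_uminus_at_bot_at_top[THEN filterlim_compose] ray_at_top)
  show "\<forall>\<^sub>F t in at_top. exp (Re (poly P (of_real t * u))) \<le> exp (- (t ^ d / (4 * d)))"
    using eventually_ge_at_top[of R]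
  proof eventually_elim
    case (elim t)
    have t: "t \<ge> 1" using elim R by simp
    have "t ^ d * (1 / 2) \<le> t ^ d * Re (u ^ d)" using assms t by (intro mult_left_mono) auto
    then show ?case
      using Re_P_le[of "of_real t * u"] assms t elim
      by (simp add: norm_mult power_mult_distrib flip: of_real_power)
  qed
qed simp

text \<open>The radial estimate is a Cauchy condition at infinity. It is exploited along the integers first,
  and then transferred to real parameters by the same estimate.\<close>

lemma ray_limit_exists:
  assumes u: "norm u = 1" "1 / 2 \<le> Re (u ^ d)"
  obtains l where "((\<lambda>t. H (of_real t * u)) \<longlongrightarrow> l) at_top"
proof -
  define e where "e = (\<lambda>t. 4 * C * exp (Re (poly P (of_real t * u))))"
  have e0: "(e \<longlongrightarrow> 0) at_top"
    unfolding e_def by (intro tendsto_mult_right_zero exp_P_ray_tendsto_0 u)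
  have bound: "norm (H (of_real t * u) - H (of_real s * u)) \<le> e s" if "R \<le> s" "s \<le> t" for s t
  proof -
    have "norm (H (of_real t * u) - H (of_real s * u)) \<le> e s - e t"
      using radial_estimate[of u s t "- 1"] u that by (simp add: e_def algebra_simps)
    also have "\<dots> \<le> e s" using C by (simp add: e_def)
    finally show ?thesis .
  qed
  define X where "X = (\<lambda>n. H (of_real (real n) * u))"
  have "Cauchy X"
  proof (rule metric_CauchyI)
    fix \<epsilon> :: real assume "0 < \<epsilon>"
    then have "\<forall>\<^sub>F n in sequentially. e (real n) < \<epsilon> / 2 \<and> R \<le> real n"
      using filterlim_compose[OF e0 filterlim_real_sequentially]
      by (intro eventually_conj order_tendstoD(2)[of _ 0]
          filterlim_real_sequentially[unfolded filterlim_at_top, rule_format]) auto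
    then obtain N where N: "\<And>n. n \<ge> N \<Longrightarrow> e (real n) < \<epsilon> / 2 \<and> R \<le> real n"
      by (auto simp: eventually_sequentially)
    have "dist (X m) (X N) < \<epsilon> / 2" if "m \<ge> N" for m
      using bound[of "real N" "real m"] N[of N] that by (simp add: X_def dist_norm)
    then show "\<exists>M. \<forall>m\<ge>M. \<forall>n\<ge>M. dist (X m) (X n) < \<epsilon>"
      by (meson dist_triangle_half_l)
  qed
  then obtain l where l: "X \<longlonglongrightarrow> l" using Cauchy_convergent convergent_def by blast
  have le: "norm (H (of_real s * u) - l) \<le> e s" if "R \<le> s" for s
  proof (rule tendsto_upperbound)
    show "(\<lambda>n. norm (H (of_real s * u) - X n)) \<longlonglongrightarrow> norm (H (of_real s * u) - l)"
      by (intro tendsto_intros l)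
    show "\<forall>\<^sub>F n in sequentially. norm (H (of_real s * u) - X n) \<le> e s"
      using filterlim_real_sequentially[unfolded filterlim_at_top, rule_format, of s]
      by eventually_elim (use bound that in \<open>simp add: X_def norm_minus_commute del: of_real_of_nat_eq\<close>)
  qed auto
  have "((\<lambda>t. H (of_real t * u) - l) \<longlongrightarrow> 0) at_top"
    by (rule Lim_null_comparison[OF eventually_mono[OF eventually_ge_at_top[of R] le] e0])
  then show thesis using that by (simp flip: Lim_null)
qed

text \<open>The arc of radius \<open>t\<close> joining two rays of the sector has length proportional to \<open>t\<close>, and there the
  integrand is of size \<open>t^(d - 1) exp (- t^d / (4 d))\<close>. Hence the limits along both rays agree.
  Since \<open>Re P\<close> need not be monotone on the arc near \<open>\<omega>\<close>, the increment of \<open>H\<close> is bounded by the length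
  of the arc and not by \<open>path_estimate\<close>.\<close>

lemma limit_in_sector:
  fixes \<sigma> \<theta> :: real
  assumes \<omega>: "\<omega> ^ d = 1" and \<sigma>: "\<sigma> = 1 \<or> \<sigma> = - 1" and \<theta>: "0 \<le> \<theta>" "d * \<theta> \<le> pi / 3"
    and lim: "((\<lambda>t. H (of_real t * \<omega>)) \<longlongrightarrow> 0) at_top"
  shows "((\<lambda>t. H (of_real t * (\<omega> * cis (\<sigma> * \<theta>)))) \<longlongrightarrow> 0) at_top"
proof -
  have n\<omega>: "norm \<omega> = 1" by (rule norm_root_of_unity[OF d \<omega>])
  define e where "e = (\<lambda>t::real. C * t ^ d * exp (- (t ^ d / (4 * d))) * \<theta>)"
  have bound: "norm (H (of_real t * \<omega> * cis (\<sigma> * \<theta>)) - H (of_real t * \<omega> * cis (\<sigma> * 0))) \<le> e t"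
    if t: "R \<le> t" for t
  proof (cases "\<theta> = 0")
    case False
    define z where "z = of_real t * \<omega>"
    define \<gamma> where "\<gamma> = (\<lambda>x. z * cis (\<sigma> * x))"
    define B where "B = C * t ^ d * exp (- (t ^ d / (4 * d)))"
    have t1: "t \<ge> 1" using t R by simp
    have n\<gamma>: "norm (\<gamma> x) = t" for x using n\<omega> t1 by (simp add: \<gamma>_def z_def norm_mult)
    have H': "((\<lambda>x. H (\<gamma> x)) has_vector_derivative
        of_real \<sigma> * \<i> * \<gamma> x * (poly Q (\<gamma> x) * exp (poly P (\<gamma> x)))) (at x)" for x
      using field_vector_diff_chain_at[OF arc_derivative H] by (simp add: o_def \<gamma>_def)
    have "norm (H (\<gamma> \<theta>) - H (\<gamma> 0)) \<le> B * \<theta> - B * 0"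
    proof (rule differentiable_bound_general[OF _ _ _ H', where \<phi> = "\<lambda>x. B * x" and \<phi>' = "\<lambda>_. B"])
      show "0 < \<theta>" using False \<theta> by simp
      show "continuous_on {0..\<theta>} (\<lambda>x. H (\<gamma> x))"
        using has_vector_derivative_continuous[OF H']
        by (auto simp: continuous_on_eq_continuous_within continuous_at_imp_continuous_within)
      show "((\<lambda>x. B * x) has_vector_derivative B) (at x)" for x
        by (auto intro!: derivative_eq_intros simp: has_vector_derivative_def)
      fix x assume x: "0 < x" "x < \<theta>"
      have "(\<gamma> x) ^ d = of_real (t ^ d) * cis (real d * (\<sigma> * x))"
        using \<omega> by (simp add: \<gamma>_def z_def power_mult_distrib Complex.DeMoivre)
      moreover have "cos (real d * (\<sigma> * x)) = cos (real d * x)" using \<sigma> by auto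
      moreover have "cos (real d * x) \<ge> cos (pi / 3)"
      proof (rule cos_monotone_0_pi_le)
        have "real d * x \<le> real d * \<theta>" using x by (intro mult_left_mono) auto
        then show "real d * x \<le> pi / 3" using \<theta> by linarith
      qed (use x in auto)
      ultimately have "t ^ d / 2 \<le> Re (\<gamma> x ^ d)"
        using t1 mult_left_mono[of "1/2" "cos (real d * x)" "t ^ d"] by (simp add: cos_60)
      then have "Re (poly P (\<gamma> x)) \<le> - (t ^ d / (4 * d))"
        using Re_P_le[of "\<gamma> x"] n\<gamma> t by simp
      then have "t * norm (poly Q (\<gamma> x)) * exp (Re (poly P (\<gamma> x))) \<le> B"
        unfolding B_def using Q_le'[of "\<gamma> x"] n\<gamma> t C t1
        by (intro mult_mono[of "t * norm (poly Q (\<gamma> x))"]) auto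
      then show "norm (of_real \<sigma> * \<i> * \<gamma> x * (poly Q (\<gamma> x) * exp (poly P (\<gamma> x)))) \<le> B"
        using \<sigma> n\<gamma> by (auto simp: norm_mult mult_ac)
    qed (auto intro!: continuous_intros)
    then show ?thesis by (simp add: e_def B_def \<gamma>_def z_def)
  qed (simp add: e_def)
  have "((\<lambda>t. (t ^ d / (4 * d)) ^ 1 / exp (t ^ d / (4 * d))) \<longlongrightarrow> 0) (at_top :: real filter)"
    by (rule filterlim_compose[OF tendsto_power_div_exp_0 ray_at_top])
  then have "((\<lambda>t. (C * \<theta> * (4 * d)) * ((t ^ d / (4 * d)) ^ 1 / exp (t ^ d / (4 * d)))) \<longlongrightarrow> 0)
      (at_top :: real filter)"
    by (rule tendsto_mult_right_zero)
  also have "(\<lambda>t. (C * \<theta> * (4 * d)) * ((t ^ d / (4 * d)) ^ 1 / exp (t ^ d / (4 * d)))) = e"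
    using d by (auto simp: e_def fun_eq_iff exp_minus field_simps)
  finally have e0: "(e \<longlongrightarrow> 0) at_top" .
  have "((\<lambda>t. H (of_real t * \<omega> * cis (\<sigma> * \<theta>)) - H (of_real t * \<omega>)) \<longlongrightarrow> 0) at_top"
    by (rule Lim_null_comparison[OF eventually_mono[OF eventually_ge_at_top[of R]] e0])
      (use bound in auto)
  from tendsto_add[OF this lim] show ?thesis by (simp add: mult.assoc)
qed

section \<open>Boundedness in all directions\<close>

text \<open>Liouville's theorem for \<open>E = H e\<^sup>-\<^sup>P\<close>. In the sectors where \<open>e\<^sup>P\<close> grows, the bound starts from the
  maximum \<open>M\<close> of \<open>|E|\<close> on the disc of radius \<open>R\<close>; in the other directions it starts from the limit \<open>0\<close> of
  \<open>H\<close> at infinity.\<close>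

lemma primitive_eq_0:
  assumes H0: "H 0 = 0"
    and lim: "\<And>\<omega>. \<omega> ^ d = 1 \<Longrightarrow> ((\<lambda>t. H (of_real t * \<omega>)) \<longlongrightarrow> 0) at_top"
  shows "H z = 0"
proof -
  define E where "E = (\<lambda>z. H z * exp (- poly P z))"
  have norm_E: "norm (E z) = norm (H z) / exp (Re (poly P z))" for z
    by (simp add: E_def norm_mult exp_minus divide_inverse norm_inverse)
  have "H holomorphic_on UNIV"
    using H by (auto simp: holomorphic_on_open)
  then have hol: "E holomorphic_on UNIV"
    unfolding E_def by (intro holomorphic_intros)
  have "continuous_on (cball 0 R) E"
    by (rule holomorphic_on_imp_continuous_on[OF holomorphic_on_subset[OF hol]]) simp
  then have "bounded (E ` cball 0 R)"
    by (intro compact_imp_bounded compact_continuous_image compact_cball)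
  then obtain M where M: "0 < M" "\<And>z. norm z \<le> R \<Longrightarrow> norm (E z) \<le> M"
    unfolding bounded_pos by auto
  then have M': "norm (H z) \<le> M * exp (Re (poly P z))" if "norm z \<le> R" for z
    using M(2)[OF that] by (simp add: norm_E divide_le_eq)
  have H_le: "norm (H z) \<le> (4 * C + M) * exp (Re (poly P z))" if "R \<le> norm z" for z
  proof -
    define r where "r = norm z"
    have r: "R \<le> r" "0 < r" using that R by (auto simp: r_def)
    obtain \<omega> :: complex and \<sigma> \<theta> :: real where \<omega>: "\<omega> ^ d = 1" and \<sigma>: "\<sigma> = 1 \<or> \<sigma> = - 1"
      and \<theta>: "0 \<le> \<theta>" "d * \<theta> \<le> pi" and z: "z = of_real r * (\<omega> * cis (\<sigma> * \<theta>))"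
      unfolding r_def using nearest_root_of_unity[OF d] by metis
    define u where "u = (\<lambda>x. \<omega> * cis (\<sigma> * x))"
    have n\<omega>: "norm \<omega> = 1" by (rule norm_root_of_unity[OF d \<omega>])
    have nu: "norm (u x) = 1" for x by (simp add: u_def norm_mult n\<omega>)
    have u_pow: "u x ^ d = cis (real d * (\<sigma> * x))" for x
      using \<omega> by (simp add: u_def power_mult_distrib Complex.DeMoivre)
    have Re_u: "Re (u x ^ d) = cos (real d * x)" for x
      unfolding u_pow using \<sigma> by auto
    have Im_u: "\<sigma> * Im (u x ^ d) = sin (real d * x)" for x
      unfolding u_pow using \<sigma> by auto
    have decay: "norm (H (of_real r * u x)) \<le> 4 * C * exp (Re (poly P (of_real r * u x)))"
      if x: "0 \<le> x" "d * x \<le> pi / 3" for x :: real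
    proof (rule tendsto_upperbound)
      show "((\<lambda>t. norm (H (of_real t * u x) - H (of_real r * u x))) \<longlongrightarrow> norm (H (of_real r * u x))) at_top"
        using tendsto_norm[OF tendsto_diff[OF limit_in_sector[OF \<omega> \<sigma> x lim[OF \<omega>]] tendsto_const]]
        unfolding u_def by simp
      have "cos (pi / 3) \<le> cos (real d * x)"
        using x by (intro cos_monotone_0_pi_le) auto
      then have "1 / 2 \<le> Re (u x ^ d)" by (simp add: Re_u cos_60)
      then have "norm (H (of_real t * u x) - H (of_real r * u x))
          \<le> 4 * C * exp (Re (poly P (of_real r * u x)))" if "r \<le> t" for t
        using radial_estimate[of "u x" r t "- 1"] nu r that C
        by (simp add: algebra_simps) (smt (verit) exp_gt_zero mult_pos_pos)
      then show "\<forall>\<^sub>F t in at_top. norm (H (of_real t * u x) - H (of_real r * u x))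
          \<le> 4 * C * exp (Re (poly P (of_real r * u x)))"
        by (rule eventually_mono[OF eventually_ge_at_top])
    qed simp
    consider "d * \<theta> \<le> pi / 3" | "pi / 3 \<le> d * \<theta>" "d * \<theta> \<le> 2 * pi / 3" | "2 * pi / 3 \<le> d * \<theta>"
      by linarith
    then have "norm (H (of_real r * u \<theta>)) \<le> (4 * C + M) * exp (Re (poly P (of_real r * u \<theta>)))"
    proof cases
      case 1
      have "norm (H (of_real r * u \<theta>)) \<le> 4 * C * exp (Re (poly P (of_real r * u \<theta>)))"
        using decay \<theta> 1 by simp
      also have "\<dots> \<le> (4 * C + M) * exp (Re (poly P (of_real r * u \<theta>)))"
        using M by simp
      finally show ?thesis .
    next
      case 2
      define \<alpha> where "\<alpha> = pi / (3 * d)"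
      have d\<alpha>: "d * \<alpha> = pi / 3" using d by (simp add: \<alpha>_def)
      have "\<alpha> \<le> \<theta>" using 2(1) d by (simp add: \<alpha>_def field_simps)
      have u_assoc: "of_real r * \<omega> * cis (\<sigma> * x) = of_real r * u x" for x by (simp add: u_def)
      have "norm (H (of_real r * u \<theta>) - H (of_real r * u \<alpha>))
          \<le> 4 * C * (exp (Re (poly P (of_real r * u \<theta>))) - exp (Re (poly P (of_real r * u \<alpha>))))"
      proof (rule arc_estimate[of "of_real r * \<omega>" \<alpha> \<theta> \<sigma>, unfolded u_assoc])
        show "R \<le> norm (of_real r * \<omega>)" using r n\<omega> by (simp add: norm_mult)
        fix x assume x: "\<alpha> \<le> x" "x \<le> \<theta>"
        have "pi / 3 \<le> d * x" "d * x \<le> 2 * pi / 3"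
          using mult_left_mono[OF x(1), of "real d"] mult_left_mono[OF x(2), of "real d"] 2 d\<alpha>
          by auto
        \<comment> \<open>\<open>cos (d x - \<pi> / 2) = sin (d x)\<close>, and the cosine decreases away from \<open>0\<close>\<close>
        then have "\<bar>d * x - pi / 2\<bar> \<le> pi / 3"
          using pi_gt_zero by linarith
        then have "cos (pi / 3) \<le> cos \<bar>d * x - pi / 2\<bar>"
          by (intro cos_monotone_0_pi_le) auto
        then have "1 / 2 \<le> sin (d * x)"
          by (simp add: cos_60 cos_diff)
        then show "norm (of_real r * \<omega>) ^ d / 2 \<le> \<sigma> * Im ((of_real r * u x) ^ d)"
        proof -
          have "\<sigma> * Im ((of_real r * u x) ^ d) = r ^ d * (\<sigma> * Im (u x ^ d))"
            by (simp add: power_mult_distrib flip: of_real_power)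
          also have "\<dots> \<ge> r ^ d * (1 / 2)"
            unfolding Im_u using r \<open>1 / 2 \<le> sin (d * x)\<close> by (intro mult_left_mono) auto
          finally show ?thesis using r n\<omega> by (simp add: norm_mult)
        qed
      qed (use \<open>\<alpha> \<le> \<theta>\<close> \<sigma> in auto)
      moreover have "norm (H (of_real r * u \<alpha>)) \<le> 4 * C * exp (Re (poly P (of_real r * u \<alpha>)))"
        using d\<alpha> by (intro decay) (auto simp: \<alpha>_def)
      ultimately have "norm (H (of_real r * u \<theta>)) \<le> 4 * C * exp (Re (poly P (of_real r * u \<theta>)))"
        using norm_triangle_sub[of "H (of_real r * u \<theta>)" "H (of_real r * u \<alpha>)"]
        by (simp add: right_diff_distrib)
      also have "\<dots> \<le> (4 * C + M) * exp (Re (poly P (of_real r * u \<theta>)))"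
        using M by simp
      finally show ?thesis .
    next
      case 3
      have "cos (real d * \<theta>) \<le> cos (2 * pi / 3)"
        using \<theta> 3 by (intro cos_monotone_0_pi_le) auto
      then have "Re (u \<theta> ^ d) \<le> - 1 / 2" by (simp add: Re_u cos_120)
      then have *: "norm (H (of_real r * u \<theta>) - H (of_real R * u \<theta>))
          \<le> 4 * C * (exp (Re (poly P (of_real r * u \<theta>))) - exp (Re (poly P (of_real R * u \<theta>))))"
        using radial_estimate[of "u \<theta>" R r 1] nu r by simp
      then have "0 \<le> 4 * C * (exp (Re (poly P (of_real r * u \<theta>))) - exp (Re (poly P (of_real R * u \<theta>))))"
        using norm_ge_zero order_trans by blast
      then have mono: "exp (Re (poly P (of_real R * u \<theta>))) \<le> exp (Re (poly P (of_real r * u \<theta>)))"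
        using C by (simp add: zero_le_mult_iff)
      have "norm (H (of_real R * u \<theta>)) \<le> M * exp (Re (poly P (of_real R * u \<theta>)))"
        using R nu by (intro M') (simp add: norm_mult)
      also have "\<dots> \<le> M * exp (Re (poly P (of_real r * u \<theta>)))"
        using mono M by (intro mult_left_mono) auto
      finally have "norm (H (of_real R * u \<theta>)) \<le> M * exp (Re (poly P (of_real r * u \<theta>)))" .
      moreover have "0 \<le> C * exp (Re (poly P (of_real R * u \<theta>)))" using C by simp
      ultimately show ?thesis
        using * norm_triangle_sub[of "H (of_real r * u \<theta>)" "H (of_real R * u \<theta>)"]
        by (simp add: algebra_simps)
    qed
    then show ?thesis by (simp add: z u_def)
  qed
  have "norm (E z) \<le> 4 * C + M" for z
  proof (cases "norm z \<le> R")
    case True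
    then show ?thesis using M(2)[of z] C by simp
  next
    case False
    then show ?thesis using H_le[of z] by (simp add: norm_E divide_le_eq)
  qed
  then have "bounded (range E)" by (auto simp: bounded_iff)
  from Liouville_theorem[OF hol this] have "E z = E 0" by (metis UNIV_I constant_on_def)
  then show ?thesis by (simp add: E_def H0)
qed

end

section \<open>Normalized polynomials and their ray limits\<close>

lemma degree_normalized_tail: "1 \<le> d \<Longrightarrow> degree (\<Sum>j<d. monom (c j) j :: complex poly) < d"
  by (intro degree_sum_less) (auto intro: le_less_trans[OF degree_monom_le])

lemma degree_pderiv_normalized: "1 \<le> d \<Longrightarrow> degree (pderiv (normalized_poly d c)) < d"
proof -
  assume d: "1 \<le> d"
  have "degree (normalized_poly d c) \<le> d"
    unfolding normalized_poly_def using degree_normalized_tail[OF d, of c]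
    by (intro degree_add_le degree_monom_le) auto
  with d show ?thesis by (simp add: degree_pderiv)
qed

lemma coeff_normalized_poly:
  "coeff (normalized_poly d c) n = (if n = d then - (1 / of_nat d) else if n < d then c n else 0)"
  by (auto simp: normalized_poly_def coeff_sum)

lemma normalized_exp_poly_integral:
  assumes d: "1 \<le> d" and "degree Q < d"
    and H: "\<And>z. (H has_field_derivative poly Q z * exp (poly (normalized_poly d c) z)) (at z)"
  obtains C R where "exp_poly_integral d (normalized_poly d c) Q H C R"
proof -
  define L where "L = (\<Sum>j<d. monom (c j) j)"
  have degL: "degree L < d" unfolding L_def by (rule degree_normalized_tail[OF d])
  have "degree (pCons 0 (pderiv L)) < d"
    using degL by (simp add: degree_pCons_eq_if degree_pderiv pderiv_eq_0_iff)
  then obtain R1 where R1: "R1 \<ge> 1"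
    "\<And>z. R1 \<le> norm z \<Longrightarrow> norm (poly (pCons 0 (pderiv L)) z) \<le> 1 / 4 * norm z ^ d"
    by (rule poly_negligible[where \<epsilon> = "1 / 4"]) auto
  obtain R2 where R2: "R2 \<ge> 1"
    "\<And>z. R2 \<le> norm z \<Longrightarrow> norm (poly L z) \<le> 1 / (4 * d) * norm z ^ d"
    using d by (rule_tac poly_negligible[OF degL, where \<epsilon> = "1 / (4 * d)"]) auto
  have "degree Q \<le> d - 1" using assms by simp
  then obtain B where B: "B \<ge> 0" "\<And>z. 1 \<le> norm z \<Longrightarrow> norm (poly Q z) \<le> B * norm z ^ (d - 1)"
    using poly_growth[of Q "d - 1"] by blast
  have "exp_poly_integral d (normalized_poly d c) Q H (B + 1) (max R1 R2)"
  proof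
    fix z :: complex assume z: "max R1 R2 \<le> norm z"
    have "norm (poly Q z) \<le> B * norm z ^ (d - 1)" using B z R1 by simp
    then show "norm (poly Q z) \<le> (B + 1) * norm z ^ (d - 1)"
      by (simp add: distrib_right add_increasing2)
    have "pderiv (normalized_poly d c) = monom (- 1) (d - 1) + pderiv L"
      using d by (simp add: normalized_poly_def pderiv_add pderiv_monom flip: L_def)
    moreover have "z * z ^ (d - 1) = z ^ d"
      using d by (simp flip: power_Suc)
    ultimately have "z * poly (pderiv (normalized_poly d c)) z + z ^ d = poly (pCons 0 (pderiv L)) z"
      by (simp add: poly_monom right_diff_distrib)
    then show "norm (z * poly (pderiv (normalized_poly d c)) z + z ^ d) \<le> norm z ^ d / 4"
      using R1(2)[of z] z by simp
    have "poly (normalized_poly d c) z + z ^ d / of_nat d = poly L z"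
      by (simp add: normalized_poly_def poly_monom flip: L_def)
    then show "norm (poly (normalized_poly d c) z + z ^ d / of_nat d) \<le> norm z ^ d / (4 * d)"
      using R2(2)[of z] z by simp
  qed (use d H B R1 in auto)
  then show thesis by (rule that)
qed

text \<open>The integral along the segment is the difference of values of an entire primitive.\<close>

lemma exp_primitive_deriv:
  "(exp_primitive P j has_field_derivative z ^ j * exp (poly P z)) (at z)" (is ?thesis1)
  and exp_primitive_0: "exp_primitive P j 0 = 0" (is ?thesis2)
proof -
  have "(\<lambda>t. t ^ j * exp (poly P t)) holomorphic_on UNIV" by (intro holomorphic_intros)
  then obtain g where g: "\<And>x. (g has_field_derivative x ^ j * exp (poly P x)) (at x)"
    using holomorphic_convex_primitive'[of UNIV] by auto
  have eq: "exp_primitive P j = (\<lambda>z. g z - g 0)"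
  proof
    fix z
    have "((\<lambda>t. t ^ j * exp (poly P t)) has_contour_integral g z - g 0) (linepath 0 z)"
      using contour_integral_primitive[of UNIV g _ "linepath 0 z"] g by simp
    then show "exp_primitive P j z = g z - g 0"
      unfolding exp_primitive_def by (rule contour_integral_unique)
  qed
  show ?thesis1 unfolding eq using g[of z] by (auto intro!: derivative_eq_intros)
  show ?thesis2 by (simp add: eq)
qed

lemma exp_primitive_combination_deriv:
  assumes "degree A < d"
  shows "((\<lambda>z. \<Sum>j<d. coeff A j * exp_primitive P j z) has_field_derivative
      poly A z * exp (poly P z)) (at z)"
proof -
  have "poly A z = (\<Sum>j<d. coeff A j * z ^ j)"
    unfolding poly_altdef using assms
    by (intro sum.mono_neutral_left) (auto simp: coeff_eq_0)
  then show ?thesis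
    by (auto intro!: derivative_eq_intros exp_primitive_deriv simp: sum_distrib_left mult_ac)
qed

lemma exp_primitive_tendsto_ray_limit:
  assumes d: "1 \<le> d" and "\<omega> ^ d = 1" and "j < d"
  shows "((\<lambda>t. exp_primitive (normalized_poly d c) j (of_real t * \<omega>))
    \<longlongrightarrow> ray_limit (exp_primitive (normalized_poly d c) j) \<omega>) at_top"
proof -
  have "norm \<omega> = 1" by (rule norm_root_of_unity) (use assms in auto)
  have "degree (monom 1 j :: complex poly) < d" using assms by (simp add: degree_monom_eq)
  then obtain C R where "exp_poly_integral d (normalized_poly d c) (monom 1 j)
      (exp_primitive (normalized_poly d c) j) C R"
    by (rule normalized_exp_poly_integral[OF d, where H = "exp_primitive (normalized_poly d c) j" and c = c])
      (auto simp: poly_monom intro: exp_primitive_deriv)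
  then obtain l where
    "((\<lambda>t. exp_primitive (normalized_poly d c) j (of_real t * \<omega>)) \<longlongrightarrow> l) at_top"
    by (rule exp_poly_integral.ray_limit_exists) (use \<open>norm \<omega> = 1\<close> assms in auto)
  then show ?thesis
    unfolding ray_limit_def by (simp add: tendsto_Lim)
qed

text \<open>This is the nonsingularity of the matrix of ray limits: a combination of its rows that vanishes
  is the limit of the primitive of \<open>A e\<^sup>P\<close> along the rays, and \<open>primitive_eq_0\<close> applies.\<close>

lemma ray_limits_independent:
  assumes d: "1 \<le> d" and deg: "degree A < d"
    and zero: "\<And>\<omega>. \<omega> ^ d = 1 \<Longrightarrow>
      (\<Sum>j<d. coeff A j * ray_limit (exp_primitive (normalized_poly d c) j) \<omega>) = 0"
  shows "A = 0"
proof -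
  define H where "H = (\<lambda>z. \<Sum>j<d. coeff A j * exp_primitive (normalized_poly d c) j z)"
  have H': "(H has_field_derivative poly A z * exp (poly (normalized_poly d c) z)) (at z)" for z
    unfolding H_def by (rule exp_primitive_combination_deriv[OF deg])
  obtain C R where "exp_poly_integral d (normalized_poly d c) A H C R"
    by (rule normalized_exp_poly_integral[OF d deg H'])
  then have "H z = 0" for z
  proof (rule exp_poly_integral.primitive_eq_0)
    show "H 0 = 0" by (simp add: H_def exp_primitive_0)
    fix \<omega> :: complex assume \<omega>: "\<omega> ^ d = 1"
    show "((\<lambda>t. H (of_real t * \<omega>)) \<longlongrightarrow> 0) at_top"
      unfolding H_def zero[OF \<omega>, symmetric]
      by (intro tendsto_sum tendsto_mult tendsto_const exp_primitive_tendsto_ray_limit d \<omega>) simp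
  qed
  then have "H = (\<lambda>_. 0)" by auto
  then have "poly A z = 0" for z
    using DERIV_unique[OF H'[of z], of 0] by simp
  then show ?thesis using poly_all_0_iff_0 by blast
qed

text \<open>The integral of \<open>P' e\<^sup>P\<close> from \<open>0\<close> is \<open>exp (P z) - exp (P 0)\<close>, and the first term tends to \<open>0\<close> along
  the ray.\<close>

lemma ray_limits_pderiv:
  assumes d: "1 \<le> d" and \<omega>: "\<omega> ^ d = 1" and P: "P = normalized_poly d c"
  shows "(\<Sum>j<d. coeff (pderiv P) j * ray_limit (exp_primitive P j) \<omega>) = - exp (poly P 0)"
proof -
  define H where "H = (\<lambda>z. \<Sum>j<d. coeff (pderiv P) j * exp_primitive P j z)"
  have deg: "degree (pderiv P) < d" using degree_pderiv_normalized[OF d] P by simp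
  have H': "(H has_field_derivative poly (pderiv P) z * exp (poly P z)) (at z)" for z
    unfolding H_def by (rule exp_primitive_combination_deriv[OF deg])
  have "((\<lambda>z. H z - exp (poly P z)) has_field_derivative 0) (at z)" for z
    by (auto intro!: derivative_eq_intros H' poly_DERIV)
  then obtain k where "\<And>z. H z - exp (poly P z) = k"
    using has_field_derivative_zero_constant[of UNIV "\<lambda>z. H z - exp (poly P z)"] by auto
  then have "H z - exp (poly P z) = H 0 - exp (poly P 0)" for z
    by simp
  moreover have "H 0 = 0" by (simp add: H_def exp_primitive_0)
  ultimately have H_eq: "H z = exp (poly P z) - exp (poly P 0)" for z by (simp add: algebra_simps)
  have n\<omega>: "norm \<omega> = 1" by (rule norm_root_of_unity[OF d \<omega>])
  obtain C R where "exp_poly_integral d P (pderiv P) H C R"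
    using H' by (rule normalized_exp_poly_integral[OF d deg, of H c, folded P])
  then have "((\<lambda>t. exp (Re (poly P (of_real t * \<omega>)))) \<longlongrightarrow> 0) at_top"
    by (rule exp_poly_integral.exp_P_ray_tendsto_0) (use n\<omega> \<omega> in auto)
  then have "((\<lambda>t. exp (poly P (of_real t * \<omega>))) \<longlongrightarrow> 0) at_top"
    by (subst tendsto_norm_zero_iff[symmetric]) simp
  then have "((\<lambda>t. H (of_real t * \<omega>)) \<longlongrightarrow> 0 - exp (poly P 0)) at_top"
    unfolding H_eq by (intro tendsto_diff tendsto_const)
  then have lim0: "((\<lambda>t. H (of_real t * \<omega>)) \<longlongrightarrow> - exp (poly P 0)) at_top"
    by simp
  have "((\<lambda>t. H (of_real t * \<omega>))
      \<longlongrightarrow> (\<Sum>j<d. coeff (pderiv P) j * ray_limit (exp_primitive P j) \<omega>)) at_top"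
    unfolding H_def P
    by (intro tendsto_sum tendsto_mult tendsto_const exp_primitive_tendsto_ray_limit d \<omega>) simp
  then show ?thesis
    by (rule tendsto_unique[OF trivial_limit_at_top_linorder _ lim0])
qed

theorem mainTheorem18:
  fixes d :: nat and \<omega> :: "nat \<Rightarrow> complex" and a b :: "nat \<Rightarrow> complex"
    and P0 Q0 :: "complex poly" and F G :: "nat \<Rightarrow> complex \<Rightarrow> complex"
  assumes "d \<ge> 1"
    and "bij_betw \<omega> {1..d} {z. z ^ d = 1}"
    and "P0 = normalized_poly d a"
    and "Q0 = normalized_poly d b"
    and "\<And>j. F j = exp_primitive P0 j"
    and "\<And>j. G j = exp_primitive Q0 j"
    and "\<forall>j\<in>{0..<d}. \<forall>k\<in>{1..d}. ray_limit (F j) (\<omega> k) = ray_limit (G j) (\<omega> k)"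
  shows "(\<forall>j\<in>{1..<d}. exp (a 0) * a j = exp (b 0) * b j) \<and>
         (\<forall>z. exp (poly P0 0) * (poly P0 z - poly P0 0)
            = exp (poly Q0 0) * (poly Q0 z - poly Q0 0)) \<and>
         (coeff P0 0 = 0 \<and> coeff Q0 0 = 0 \<longrightarrow> P0 = Q0)"
proof -
  note d = assms(1) and P0 = assms(3) and Q0 = assms(4)
  define A where "A = smult (exp (- poly P0 0)) (pderiv P0) - smult (exp (- poly Q0 0)) (pderiv Q0)"
  have "A = 0"
  proof (rule ray_limits_independent[OF d, where c = a])
    show "degree A < d"
      unfolding A_def P0 Q0
      by (intro degree_diff_less; rule le_less_trans[OF degree_smult_le degree_pderiv_normalized[OF d]])
    fix z :: complex assume z: "z ^ d = 1"
    then have "z \<in> \<omega> ` {1..d}"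
      unfolding bij_betw_imp_surj_on[OF assms(2)] by simp
    then obtain k where k: "k \<in> {1..d}" "\<omega> k = z"
      by (rule imageE) simp
    have eq: "ray_limit (exp_primitive P0 j) z = ray_limit (exp_primitive Q0 j) z" if "j < d" for j
      using assms(5-7) k that by auto
    have Q: "(\<Sum>j<d. coeff (pderiv Q0) j * ray_limit (exp_primitive P0 j) z) = - exp (poly Q0 0)"
      using ray_limits_pderiv[OF d z Q0] by (simp add: eq)
    have "(\<Sum>j<d. coeff A j * ray_limit (exp_primitive P0 j) z)
        = exp (- poly P0 0) * (\<Sum>j<d. coeff (pderiv P0) j * ray_limit (exp_primitive P0 j) z)
        - exp (- poly Q0 0) * (\<Sum>j<d. coeff (pderiv Q0) j * ray_limit (exp_primitive P0 j) z)"
      by (simp add: A_def sum_distrib_left left_diff_distrib sum_subtractf mult.assoc)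
    also have "\<dots> = 0"
      unfolding ray_limits_pderiv[OF d z P0] Q by (simp add: exp_minus)
    finally show "(\<Sum>j<d. coeff A j * ray_limit (exp_primitive (normalized_poly d a) j) z) = 0"
      unfolding P0 .
  qed
  then have deriv: "smult (exp (- poly P0 0)) (pderiv P0) = smult (exp (- poly Q0 0)) (pderiv Q0)"
    by (simp add: A_def)
  \<comment> \<open>The common leading coefficient of both derivatives isolates the two exponential factors.\<close>
  have lead: "coeff (pderiv (normalized_poly d c)) (d - 1) = - 1" for c
    using d by (simp add: coeff_pderiv coeff_normalized_poly of_nat_diff)
  have "exp (- poly P0 0) = exp (- poly Q0 0)"
    using arg_cong[OF deriv, of "\<lambda>p. coeff p (d - 1)"] by (simp add: P0 Q0 lead del: One_nat_def)
  then have exp_eq: "exp (poly P0 0) = exp (poly Q0 0)"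
    by (simp add: exp_minus)
  have "smult (exp (- poly Q0 0)) (pderiv P0 - pderiv Q0) = 0"
    using deriv exp_eq by (simp add: exp_minus smult_diff_right)
  then have pderiv_eq: "pderiv P0 = pderiv Q0"
    by simp
  have coeffs: "coeff P0 n = coeff Q0 n" if "0 < n" for n
  proof (cases n)
    case (Suc m)
    have "of_nat (Suc m) * coeff P0 (Suc m) = of_nat (Suc m) * coeff Q0 (Suc m)"
      unfolding coeff_pderiv[symmetric] pderiv_eq ..
    then show ?thesis unfolding Suc mult_cancel_left of_nat_eq_0_iff by simp
  qed (use that in simp)
  have diff: "P0 = Q0 + [:coeff P0 0 - coeff Q0 0:]"
  proof (rule poly_eqI)
    fix n show "coeff P0 n = coeff (Q0 + [:coeff P0 0 - coeff Q0 0:]) n"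
      using coeffs[of n] by (cases n) simp_all
  qed
  have eval: "poly P0 z - poly P0 0 = poly Q0 z - poly Q0 0" for z
    by (subst (1 2) diff) simp
  have "exp (a 0) * a j = exp (b 0) * b j" if "j \<in> {1..<d}" for j
  proof -
    have "poly P0 0 = a 0" "poly Q0 0 = b 0" "coeff P0 j = a j" "coeff Q0 j = b j"
      using that by (simp_all add: P0 Q0 poly_0_coeff_0 coeff_normalized_poly)
    then show ?thesis using coeffs[of j] exp_eq that by simp
  qed
  moreover have "P0 = Q0" if "coeff P0 0 = 0" "coeff Q0 0 = 0"
    by (subst diff) (simp add: that)
  ultimately show ?thesis
    by (intro conjI ballI allI impI; (elim conjE)?) (simp_all only: exp_eq eval)
qed

end
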